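(* The following identities hold as formal power series in $q$ with coefficients in $\mathbb{Z}[x,y]$: $$1+\sum_{\lambda\in \mathcal{S}} x^{\sharp(\lambda)} y^{\sharp_{1,2}(\lambda)}q^{|\lambda|} = \sum_{i\ge 0}\sum_{j\ge 0}\frac{x^{i+j}y^jq^{i^2+j^2+i}}{(q^2;q^2)_{i+j}}\begin{bmatrix}i+1\\ j\end{bmatrix}_{q^2}.$$ Furthermore, $$\sum_{\lambda\in \mathcal{S}_E} x^{\sharp(\lambda)} y^{\sharp_{1,2}(\lambda)}q^{|\lambda|} = \sum_{i\ge 1}\sum_{j\ge 0}\frac{x^{i+j}y^jq^{i^2+j^2+i}}{(q^2;q^2)_{i+j}}\begin{bmatrix}i\\ j\end{bmatrix}_{q^2}$$ and $$\sum_{\lambda\in \mathcal{S}_O} x^{\sharp(\lambda)} y^{\sharp_{1,2}(\lambda)}q^{|\lambda|} = \sum_{i\ge 1}\sum_{j\ge 0}\frac{x^{i+j}y^{j+1}q^{i^2+j^2+i-1}}{(q^2;q^2)_{i+j}}\begin{bmatrix}i-1\\ j\end{bmatrix}_{q^2}.$$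
   Context: $\mathcal{S}$ denotes the set of nonempty integer partitions into distinct parts such that (E1) adjacent parts (i.e. consecutive parts when the parts are listed in order of size) are never both odd. $\mathcal{S}_E$ (resp. $\mathcal{S}_O$) is the set of partitions in $\mathcal{S}$ whose largest part is even (resp. odd). For an integer partition $\lambda$: $|\lambda|$ is the sum of its parts, $\sharp(\lambda)$ is the number of its parts, and $\sharp_{a,M}(\lambda)$ is the number of its parts congruent to $a$ modulo $M$; thus $\sharp_{1,2}(\lambda)$ is the number of odd parts. The $q$-Pochhammer symbol is $(A;q)_n=\prod_{k=0}^{n-1}(1-Aq^k)$, and the $q$-binomial coefficient is $\begin{bmatrix}A\\ B\end{bmatrix}_q=\dfrac{(q;q)_A}{(q;q)_B(q;q)_{A-B}}$ if $0\le B\le A$ and $0$ otherwise. The subscript $q^2$ means $q$ is replaced by $q^2$. *)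

theory Defs
  imports "HOL-Computational_Algebra.Polynomial" "HOL-Computational_Algebra.Formal_Power_Series" "HOL-Analysis.Infinite_Sum"
begin

section \<open>Integer partitions\<close>

text \<open>A partition is the weakly decreasing list of its (positive) parts.\<close>

definition is_partition :: "nat list \<Rightarrow> bool" where
  "is_partition lam \<longleftrightarrow> sorted_wrt (\<ge>) lam \<and> 0 \<notin> set lam"

definition num_parts_cong :: "nat \<Rightarrow> nat \<Rightarrow> nat list \<Rightarrow> nat" where
  "num_parts_cong a M lam = length (filter (\<lambda>p. p mod M = a mod M) lam)"

definition no_adjacent_odd :: "nat list \<Rightarrow> bool" where
  "no_adjacent_odd lam \<longleftrightarrow>
     (\<forall>k. Suc k < length lam \<longrightarrow> \<not> (odd (lam ! k) \<and> odd (lam ! Suc k)))"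

definition S_parts :: "nat list set" where
  "S_parts = {lam. is_partition lam \<and> lam \<noteq> [] \<and> distinct lam \<and> no_adjacent_odd lam}"

definition S_even :: "nat list set" where
  "S_even = {lam \<in> S_parts. even (Max (set lam))}"

definition S_odd :: "nat list set" where
  "S_odd = {lam \<in> S_parts. odd (Max (set lam))}"

section \<open>Formal power series in $q$ over $\mathbb{Z}[x,y]$\<close>

text \<open>
  The coefficient ring $\mathbb{Z}[x,y]$ is represented as $\mathbb{Z}[x][y]$: the inner polynomial
  variable is $x$, the outer one is $y$. Infinite sums of series refer to the library's metric on
  \<^typ>\<open>'a fps\<close>, which is the $q$-adic one (coefficients are discrete).
\<close>

type_synonym qseries = "int poly poly fps"

definition x_var :: qseries where
  "x_var = fps_const [:[:0, 1:]:]"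

definition y_var :: qseries where
  "y_var = fps_const [:0, 1:]"

abbreviation q_var :: qseries where
  "q_var \<equiv> fps_X"

text \<open>
  The library's division of power series needs an inverse operation on the coefficients.
  Over a ring we invert a denominator with constant coefficient 1 by
  \<open>fps_right_inverse\<close>, whose second argument is the inverse of that constant coefficient.
\<close>

definition fps_quot :: "'a::comm_ring_1 fps \<Rightarrow> 'a fps \<Rightarrow> 'a fps" where
  "fps_quot f g = f * fps_right_inverse g 1"

lemma fps_quot_mult:
  fixes f g :: "'a::comm_ring_1 fps"
  assumes "fps_nth g 0 = 1"
  shows "fps_quot f g * g = f"
proof -
  have "g * fps_right_inverse g 1 = 1"
    by (rule fps_right_inverse) (simp add: assms)
  then show ?thesis
    by (simp only: fps_quot_def mult.left_commute[of g f] mult.commute[of _ g] mult_1_right)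
qed

definition q_pochhammer :: "'a::comm_ring_1 \<Rightarrow> 'a \<Rightarrow> nat \<Rightarrow> 'a" where
  "q_pochhammer A Q n = (\<Prod>k<n. 1 - A * Q ^ k)"

lemma fps_nth_0_q_pochhammer:
  fixes A Q :: "'a::comm_ring_1 fps"
  assumes "fps_nth A 0 = 0"
  shows "fps_nth (q_pochhammer A Q n) 0 = 1"
  using assms by (induction n) (simp_all add: q_pochhammer_def)

definition q_binomial :: "'a::comm_ring_1 fps \<Rightarrow> nat \<Rightarrow> nat \<Rightarrow> 'a fps" where
  "q_binomial Q A B =
     (if B \<le> A
      then fps_quot (q_pochhammer Q Q A) (q_pochhammer Q Q B * q_pochhammer Q Q (A - B))
      else 0)"

definition partition_weight :: "nat list \<Rightarrow> qseries" where
  "partition_weight lam =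
     x_var ^ length lam * y_var ^ num_parts_cong 1 2 lam * q_var ^ sum_list lam"

end

theory Submission
  imports Defs "HOL-Analysis.Elementary_Metric_Spaces"
begin

text \<open>
  Fix the parity of the largest part, the number $n$ of parts and the number $j$ of odd parts.
  A partition in such a class is obtained either by adding 2 to every part of one in the same class,
  or by adding 2 to every part and appending a new part 2, or by appending a part 1 to a partition
  with even smallest part.  Let $F_{n,j}$ be the generating function of the class and
  $U_{n,j} = (q^2;q^2)_n F_{n,j}$.  Eliminating the classes with even smallest part gives
  $U_{n,j} = x q^{2n} U_{n-1,j} + x^2 y q^{2n-1} U_{n-2,j-1}$ for $n \ge 2$.  With $i = n - j$
  this is the $q$-Pascal rule up to a monomial factor; the two parities of the largest part differ
  only in the initial values at $n \le 1$.  The formula for all partitions is the sum of the two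
  others, by the other form of the $q$-Pascal rule.
\<close>

section \<open>Summation in the $q$-adic topology\<close>

text \<open>The rules for infinite sums over disjoint unions and over fibres ask for continuous
  addition. Near a limit each coefficient of either summand is eventually constant, hence so is that
  of the sum.\<close>

instance fps :: (comm_ring_1) topological_comm_monoid_add
proof
  fix a b :: "'a fps"
  show "((\<lambda>x. fst x + snd x) \<longlongrightarrow> a + b) (nhds a \<times>\<^sub>F nhds b)"
  proof (rule tendsto_fpsI)
    fix n
    have "\<forall>\<^sub>F x in nhds a \<times>\<^sub>F nhds b. fps_nth (fst x) n = fps_nth a n"
      using filterlim_fst[of "nhds a" "nhds b"] by (simp add: tendsto_fps_iff)
    moreover have "\<forall>\<^sub>F x in nhds a \<times>\<^sub>F nhds b. fps_nth (snd x) n = fps_nth b n"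
      using filterlim_snd[of "nhds b" "nhds a"] by (simp add: tendsto_fps_iff)
    ultimately show "\<forall>\<^sub>F x in nhds a \<times>\<^sub>F nhds b. fps_nth (fst x + snd x) n = fps_nth (a + b) n"
      by eventually_elim simp
  qed
qed

text \<open>Each coefficient receives finitely many nonzero contributions, so it is the same for all
  finite partial sums that contain them.\<close>

lemma summable_on_fpsI:
  fixes f :: "'b \<Rightarrow> 'a::comm_ring_1 fps"
  assumes fin: "\<And>n. finite {a \<in> A. fps_nth (f a) n \<noteq> 0}"
  shows "f summable_on A"
proof -
  let ?s = "Abs_fps (\<lambda>n. \<Sum>a\<in>{a \<in> A. fps_nth (f a) n \<noteq> 0}. fps_nth (f a) n)"
  have "(f has_sum ?s) A"
    unfolding has_sum_def
  proof (rule tendsto_fpsI)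
    fix n
    let ?B = "{a \<in> A. fps_nth (f a) n \<noteq> 0}"
    have "fps_nth (sum f F) n = fps_nth ?s n" if "finite F" "?B \<subseteq> F" "F \<subseteq> A" for F
    proof -
      have "fps_nth (sum f F) n = (\<Sum>a\<in>F. fps_nth (f a) n)"
        by (simp add: fps_sum_nth)
      also have "\<dots> = (\<Sum>a\<in>?B. fps_nth (f a) n)"
        using that by (intro sum.mono_neutral_right) auto
      finally show ?thesis by simp
    qed
    then show "\<forall>\<^sub>F F in finite_subsets_at_top A. fps_nth (sum f F) n = fps_nth ?s n"
      unfolding eventually_finite_subsets_at_top using fin[of n]
      by (intro exI[of _ ?B]) auto
  qed
  then show ?thesis by (rule has_sum_imp_summable)
qed

text \<open>Multiplication by \<open>c\<close> is continuous because coefficient \<open>n\<close> of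
  a product depends only on the coefficients up to \<open>n\<close>.\<close>

lemma has_sum_fps_cmult:
  fixes f :: "'b \<Rightarrow> 'a::comm_ring_1 fps"
  assumes "(f has_sum s) A"
  shows "((\<lambda>a. c * f a) has_sum (c * s)) A"
proof -
  have "((\<lambda>t. c * t) \<longlongrightarrow> c * s) (at s)"
  proof (rule tendsto_fpsI)
    fix n
    have "((\<lambda>t. t) \<longlongrightarrow> s) (at s)" by simp
    then have "\<forall>\<^sub>F t in at s. \<forall>k\<in>{..n}. fps_nth t k = fps_nth s k"
      unfolding tendsto_fps_iff by (intro eventually_ball_finite) auto
    then show "\<forall>\<^sub>F t in at s. fps_nth (c * t) n = fps_nth (c * s) n"
      by eventually_elim (simp add: fps_mult_nth)
  qed
  then have "((((*) c) \<circ> f) has_sum (c * s)) A"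
    by (intro has_sum_comm_additive_general assms) (simp_all add: o_def sum_distrib_left)
  then show ?thesis by (simp add: o_def)
qed

section \<open>$q$-binomial coefficients\<close>

lemma q_pochhammer_Suc:
  "q_pochhammer A Q (Suc n) = q_pochhammer A Q n * (1 - A * Q ^ n)"
  by (simp add: q_pochhammer_def)

lemma q_pochhammer_fps_nonzero:
  fixes A Q :: "'a::comm_ring_1 fps"
  assumes "fps_nth A 0 = 0"
  shows "q_pochhammer A Q n \<noteq> 0"
  using fps_nth_0_q_pochhammer[OF assms, of Q n] by auto

lemma q_binomial_mult:
  fixes Q :: "'a::comm_ring_1 fps"
  assumes "fps_nth Q 0 = 0" "B \<le> A"
  shows "q_binomial Q A B * (q_pochhammer Q Q B * q_pochhammer Q Q (A - B)) = q_pochhammer Q Q A"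
  using assms unfolding q_binomial_def by (simp add: fps_quot_mult fps_nth_0_q_pochhammer)

text \<open>In an integral domain the denominator cancels, since its factors have constant
  coefficient 1. Writing the upper index as \<open>B + C\<close> avoids subtraction.\<close>

lemma q_binomial_eqI:
  fixes Q :: "'a::idom fps"
  assumes "fps_nth Q 0 = 0"
    and "b * (q_pochhammer Q Q B * q_pochhammer Q Q C) = q_pochhammer Q Q (B + C)"
  shows "q_binomial Q (B + C) B = b"
proof -
  have "q_binomial Q (B + C) B * (q_pochhammer Q Q B * q_pochhammer Q Q C)
      = b * (q_pochhammer Q Q B * q_pochhammer Q Q C)"
    using q_binomial_mult[OF assms(1), of B "B + C"] assms(2) by simp
  then show ?thesis
    using q_pochhammer_fps_nonzero[OF assms(1)] by simp
qed

lemma q_binomial_eq_0: "A < B \<Longrightarrow> q_binomial Q A B = 0"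
  by (simp add: q_binomial_def)

lemma q_binomial_0:
  fixes Q :: "'a::idom fps"
  assumes "fps_nth Q 0 = 0"
  shows "q_binomial Q A 0 = 1"
  using q_binomial_eqI[OF assms, of 1 0 A] by (simp add: q_pochhammer_def)

lemma q_binomial_self:
  fixes Q :: "'a::idom fps"
  assumes "fps_nth Q 0 = 0"
  shows "q_binomial Q A A = 1"
  using q_binomial_eqI[OF assms, of 1 A 0] by (simp add: q_pochhammer_def)

text \<open>Once the common denominator \<open>?P (Suc B) * ?P (Suc C)\<close> is cleared, both
  forms amount to writing 1 - Q^(B+1) Q^(C+1) as a combination of 1 - Q^(B+1) and 1 -
  Q^(C+1).\<close>

lemma q_binomial_pascal_aux:
  fixes Q :: "'a::idom fps"
  assumes Q: "fps_nth Q 0 = 0"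
  shows "q_binomial Q (B + C + 2) (Suc B) =
           Q ^ Suc B * q_binomial Q (B + C + 1) (Suc B) + q_binomial Q (B + C + 1) B"
    and "q_binomial Q (B + C + 2) (Suc B) =
           q_binomial Q (B + C + 1) (Suc B) + Q ^ Suc C * q_binomial Q (B + C + 1) B"
proof -
  let ?P = "q_pochhammer Q Q"
  define u where "u = q_binomial Q (B + C + 1) (Suc B)"
  define v where "v = q_binomial Q (B + C + 1) B"
  have u: "u * (?P (Suc B) * ?P C) = ?P (B + C + 1)"
    using q_binomial_mult[OF Q, of "Suc B" "B + C + 1"] by (simp add: u_def)
  have v: "v * (?P B * ?P (Suc C)) = ?P (B + C + 1)"
    using q_binomial_mult[OF Q, of B "B + C + 1"] by (simp add: v_def)
  have PB: "?P (Suc B) = ?P B * (1 - Q ^ Suc B)" and PC: "?P (Suc C) = ?P C * (1 - Q ^ Suc C)"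
    and PBC: "?P (B + C + 2) = ?P (B + C + 1) * (1 - Q ^ Suc B * Q ^ Suc C)"
    using q_pochhammer_Suc[of Q Q "B + C + 1"] by (simp_all add: q_pochhammer_Suc power_add)
  \<comment> \<open>The coefficients \<open>s\<close> and \<open>t\<close> stay free so that one
    computation serves both forms.\<close>
  have *: "(s * u + t * v) * (?P (Suc B) * ?P (Suc C)) =
      ?P (B + C + 1) * (s * (1 - Q ^ Suc C) + t * (1 - Q ^ Suc B))" for s t
  proof -
    have "(s * u + t * v) * (?P (Suc B) * ?P (Suc C)) =
        s * (u * (?P (Suc B) * ?P C)) * (1 - Q ^ Suc C)
        + t * (v * (?P B * ?P (Suc C))) * (1 - Q ^ Suc B)"
      unfolding PB PC by (simp only: algebra_simps)
    then show ?thesis unfolding u v by (simp only: algebra_simps)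
  qed
  have eq: "B + C + 2 = Suc B + Suc C" by simp
  have "q_binomial Q (Suc B + Suc C) (Suc B) = Q ^ Suc B * u + 1 * v"
    by (rule q_binomial_eqI[OF Q], unfold *, fold eq, unfold PBC) (simp only: algebra_simps mult_1_left)
  then show "q_binomial Q (B + C + 2) (Suc B) =
      Q ^ Suc B * q_binomial Q (B + C + 1) (Suc B) + q_binomial Q (B + C + 1) B"
    unfolding eq u_def v_def by simp
  have "q_binomial Q (Suc B + Suc C) (Suc B) = 1 * u + Q ^ Suc C * v"
    by (rule q_binomial_eqI[OF Q], unfold *, fold eq, unfold PBC) (simp only: algebra_simps mult_1_left)
  then show "q_binomial Q (B + C + 2) (Suc B) =
      q_binomial Q (B + C + 1) (Suc B) + Q ^ Suc C * q_binomial Q (B + C + 1) B"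
    unfolding eq u_def v_def by simp
qed

lemma q_binomial_pascal:
  fixes Q :: "'a::idom fps"
  assumes Q: "fps_nth Q 0 = 0"
  shows "q_binomial Q (Suc A) (Suc B) = Q ^ Suc B * q_binomial Q A (Suc B) + q_binomial Q A B"
proof -
  consider "A < B" | "A = B" | C where "A = B + C + 1"
    by (metis add.right_neutral add_Suc_right Suc_eq_plus1 less_imp_Suc_add linorder_neqE_nat)
  then show ?thesis
    using q_binomial_pascal_aux(1)[OF Q]
    by cases (auto simp: q_binomial_eq_0 q_binomial_self[OF Q])
qed

lemma q_binomial_pascal':
  fixes Q :: "'a::idom fps"
  assumes Q: "fps_nth Q 0 = 0" and "B \<le> A"
  shows "q_binomial Q (Suc A) (Suc B) = q_binomial Q A (Suc B) + Q ^ (A - B) * q_binomial Q A B"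
proof -
  consider "A = B" | C where "A = B + C + 1"
    using assms(2) by (metis add.right_neutral add_Suc_right Suc_eq_plus1 less_imp_Suc_add le_neq_implies_less)
  then show ?thesis
    using q_binomial_pascal_aux(2)[OF Q]
    by cases (auto simp: q_binomial_eq_0 q_binomial_self[OF Q])
qed

section \<open>Classes of partitions\<close>

text \<open>The empty partition is adjoined: it starts the recursion on the number of parts and
  supplies the 1 in the first identity.\<close>

definition S_parts0 :: "nat list set" where
  "S_parts0 = {lam. is_partition lam \<and> distinct lam \<and> no_adjacent_odd lam}"

lemma S_parts0_eq: "S_parts0 = insert [] S_parts"
proof -
  have "is_partition [] \<and> distinct [] \<and> no_adjacent_odd []"
    by (simp add: is_partition_def no_adjacent_odd_def)
  then show ?thesis
    unfolding S_parts0_def S_parts_def by blast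
qed

lemma Nil_in_S_parts0 [simp]: "[] \<in> S_parts0"
  by (simp add: S_parts0_eq)

lemma sorted_wrt_ge_last_le: "sorted_wrt (\<ge>) (xs :: nat list) \<Longrightarrow> x \<in> set xs \<Longrightarrow> last xs \<le> x"
  by (induction xs rule: rev_induct) (auto simp: sorted_wrt_append)

lemma no_adjacent_odd_snoc:
  "no_adjacent_odd (lam @ [a]) \<longleftrightarrow>
     no_adjacent_odd lam \<and> (lam \<noteq> [] \<longrightarrow> even a \<or> even (last lam))"
proof (cases lam rule: rev_cases)
  case Nil
  then show ?thesis by (simp add: no_adjacent_odd_def)
next
  case (snoc mu b)
  show ?thesis
    unfolding no_adjacent_odd_def snoc
    by (auto simp: nth_append less_Suc_eq split: if_splits)
qed

text \<open>The last entry is the smallest part, so a new part at the end need only be compared with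
  it.\<close>

lemma S_parts0_snoc:
  "lam @ [a] \<in> S_parts0 \<longleftrightarrow>
     lam \<in> S_parts0 \<and> 0 < a \<and> (lam \<noteq> [] \<longrightarrow> a < last lam \<and> (even a \<or> even (last lam)))"
proof (cases "lam = []")
  case True
  then show ?thesis by (auto simp: S_parts0_def is_partition_def no_adjacent_odd_def)
next
  case False
  then have "last lam \<in> set lam" by simp
  then have "(\<forall>x\<in>set lam. a \<le> x) \<and> a \<notin> set lam \<longleftrightarrow> a < last lam" if "sorted_wrt (\<ge>) lam"
    using sorted_wrt_ge_last_le[OF that] by (metis leD le_neq_implies_less less_imp_le order.trans)
  then have "is_partition (lam @ [a]) \<and> distinct (lam @ [a]) \<longleftrightarrow>
      is_partition lam \<and> distinct lam \<and> 0 < a \<and> a < last lam"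
    unfolding is_partition_def by (auto simp: sorted_wrt_append)
  with False show ?thesis
    unfolding S_parts0_def no_adjacent_odd_snoc mem_Collect_eq by blast
qed

text \<open>Adding 2, unlike adding 1, keeps every parity and with it the condition on adjacent odd
  parts.\<close>

definition shift2 :: "nat list \<Rightarrow> nat list" where
  "shift2 = map (\<lambda>k. k + 2)"

lemma shift2_Nil [simp]: "shift2 [] = []"
  by (simp add: shift2_def)

lemma shift2_snoc [simp]: "shift2 (lam @ [a]) = shift2 lam @ [a + 2]"
  by (simp add: shift2_def)

lemma length_shift2 [simp]: "length (shift2 lam) = length lam"
  by (simp add: shift2_def)

lemma shift2_eq_Nil [simp]: "shift2 lam = [] \<longleftrightarrow> lam = []"
  by (simp add: shift2_def)

lemma hd_shift2 [simp]: "lam \<noteq> [] \<Longrightarrow> hd (shift2 lam) = hd lam + 2"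
  by (simp add: shift2_def hd_map)

lemma last_shift2 [simp]: "lam \<noteq> [] \<Longrightarrow> last (shift2 lam) = last lam + 2"
  by (cases lam rule: rev_cases) auto

lemma sum_list_shift2 [simp]: "sum_list (shift2 lam) = sum_list lam + 2 * length lam"
  by (induction lam) (auto simp: shift2_def)

lemma inj_shift2: "inj shift2"
  unfolding shift2_def by (intro inj_mapI) (simp add: inj_on_def)

text \<open>The hypothesis serves the direction from left to right, as \<open>shift2\<close> would
  turn a forbidden 0 into an admissible part 2.\<close>

lemma shift_in_S_parts0_iff:
  assumes "0 \<notin> set lam"
  shows "shift2 lam \<in> S_parts0 \<longleftrightarrow> lam \<in> S_parts0"
  using assms
  by (induction lam rule: rev_induct) (auto simp: S_parts0_snoc)

lemma zero_notin_S_parts0: "lam \<in> S_parts0 \<Longrightarrow> 0 \<notin> set lam"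
  by (simp add: S_parts0_def is_partition_def)

lemma last_S_parts0_pos: "lam \<in> S_parts0 \<Longrightarrow> lam \<noteq> [] \<Longrightarrow> 0 < last lam"
  by (metis gr0I last_in_set zero_notin_S_parts0)

lemma shift_in_S_parts0: "lam \<in> S_parts0 \<Longrightarrow> shift2 lam \<in> S_parts0"
  using shift_in_S_parts0_iff zero_notin_S_parts0 by blast

text \<open>The last part is the smallest, so every part exceeds 2, and subtracting 2 on the
  naturals is exact and leaves positive parts.\<close>

lemma S_parts0_shiftE:
  assumes "lam \<in> S_parts0" "lam \<noteq> [] \<Longrightarrow> 2 < last lam"
  obtains mu where "mu \<in> S_parts0" "lam = shift2 mu"
proof -
  let ?mu = "map (\<lambda>k. k - 2) lam"
  have gt: "2 < k" if "k \<in> set lam" for k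
    using assms that sorted_wrt_ge_last_le[of lam k]
    by (cases "lam = []") (auto simp: S_parts0_def is_partition_def)
  have lam: "lam = shift2 ?mu"
    unfolding shift2_def map_map
    by (rule map_idI[symmetric]) (use gt in force)
  have "0 \<notin> set ?mu"
    using gt by (force dest: gt)
  then have "?mu \<in> S_parts0"
    using shift_in_S_parts0_iff lam assms(1) by metis
  with lam show ?thesis by (rule that[rotated])
qed

text \<open>The cases are a smallest part above 2, equal to 2, or equal to 1. Before a final 2 all
  parts exceed 2 and so form a shift; before a final 1 the neighbour must be even.\<close>

lemma S_parts0_cases:
  assumes "lam \<in> S_parts0" "lam \<noteq> []"
  obtains (shift) mu where "mu \<in> S_parts0" "mu \<noteq> []" "lam = shift2 mu"
  | (two) mu where "mu \<in> S_parts0" "lam = shift2 mu @ [2]"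
  | (one) mu where "mu \<in> S_parts0" "mu \<noteq> [] \<Longrightarrow> even (last mu)" "lam = mu @ [1]"
proof -
  obtain nu a where lam: "lam = nu @ [a]"
    using assms(2) by (cases lam rule: rev_cases) auto
  have nu: "nu \<in> S_parts0" "0 < a" "nu \<noteq> [] \<Longrightarrow> a < last nu \<and> (even a \<or> even (last nu))"
    using assms(1) by (auto simp: lam S_parts0_snoc)
  consider "a = 1" | "a = 2" | "2 < a" using nu(2) by linarith
  then show ?thesis
  proof cases
    case 1
    with nu lam show ?thesis by (intro one[of nu]) auto
  next
    case 2
    then obtain mu where "mu \<in> S_parts0" "nu = shift2 mu"
      using S_parts0_shiftE[OF nu(1)] nu(3) by auto
    with 2 lam show ?thesis by (intro two[of mu]) auto
  next
    case 3
    then obtain mu where "mu \<in> S_parts0" "lam = shift2 mu"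
      using S_parts0_shiftE[OF assms(1)] lam by auto
    with assms(2) show ?thesis by (intro shift[of mu]) auto
  qed
qed

text \<open>The empty partition is put on the even side because appending the part 2 to it must not
  change the class; the odd classes then have no member of length 0.\<close>

definition largest_even :: "nat list \<Rightarrow> bool" where
  "largest_even lam \<longleftrightarrow> (lam = [] \<or> even (hd lam))"

text \<open>The residue is written \<open>Suc 0\<close> because the simplifier rewrites 1 to
  it.\<close>

definition S_class :: "bool \<Rightarrow> nat \<Rightarrow> nat \<Rightarrow> nat list set" where
  "S_class p n j = {lam \<in> S_parts0. largest_even lam = p \<and> length lam = n \<and> num_parts_cong (Suc 0) 2 lam = j}"

text \<open>These partitions admit a further part 1 without a change of \<open>p\<close>. The empty
  one is left out, since the largest part of \<open>[1]\<close> is odd.\<close>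

definition S_class_even_last :: "bool \<Rightarrow> nat \<Rightarrow> nat \<Rightarrow> nat list set" where
  "S_class_even_last p n j = {lam \<in> S_class p n j. lam \<noteq> [] \<and> even (last lam)}"

lemma num_parts_cong_simps [simp]:
  "num_parts_cong (Suc 0) 2 [] = 0"
  "num_parts_cong (Suc 0) 2 (lam @ [a]) = num_parts_cong (Suc 0) 2 lam + (if odd a then 1 else 0)"
  "num_parts_cong (Suc 0) 2 (shift2 lam) = num_parts_cong (Suc 0) 2 lam"
  by (simp_all add: num_parts_cong_def odd_iff_mod_2_eq_one o_def filter_map shift2_def)

lemma largest_even_simps [simp]:
  "largest_even []"
  "largest_even (lam @ [a]) \<longleftrightarrow> (if lam = [] then even a else largest_even lam)"
  "largest_even (shift2 lam) \<longleftrightarrow> largest_even lam"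
  by (cases "lam = []"; simp add: largest_even_def)+

section \<open>Decomposition of the classes by the smallest part\<close>

lemma S_class_length: "lam \<in> S_class p n j \<Longrightarrow> length lam = n"
  by (simp add: S_class_def)

text \<open>An even smallest part rules out a final 1, so two of the three cases remain. The class
  reappears on the right, which later yields a factor 1 - q^(2(n+1)).\<close>

lemma S_class_even_last_decomp:
  "S_class_even_last p (Suc n) j =
     shift2 ` S_class_even_last p (Suc n) j \<union>
     (\<lambda>mu. shift2 mu @ [2]) ` S_class p n j" (is "?L = ?R")
proof (intro set_eqI iffI)
  fix lam assume "lam \<in> ?L"
  then have lam: "lam \<in> S_parts0" "lam \<noteq> []" "largest_even lam = p" "length lam = Suc n"
     "num_parts_cong (Suc 0) 2 lam = j" "even (last lam)"
    by (auto simp: S_class_even_last_def S_class_def)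
  from lam(1,2) show "lam \<in> ?R"
  proof (cases rule: S_parts0_cases)
    case (shift mu)
    with lam have "mu \<in> S_class_even_last p (Suc n) j"
      by (auto simp: S_class_even_last_def S_class_def)
    with shift show ?thesis by blast
  next
    case (two mu)
    with lam have "mu \<in> S_class p n j"
      by (auto simp: S_class_def split: if_splits)
    with two show ?thesis by blast
  next
    case (one mu)
    with lam show ?thesis by simp
  qed
next
  fix lam assume "lam \<in> ?R"
  then show "lam \<in> ?L"
  proof
    assume "lam \<in> shift2 ` S_class_even_last p (Suc n) j"
    then show ?thesis
      by (auto simp: S_class_even_last_def S_class_def
          intro!: shift_in_S_parts0)
  next
    assume "lam \<in> (\<lambda>mu. shift2 mu @ [2]) ` S_class p n j"
    then obtain mu where mu: "mu \<in> S_class p n j" "lam = shift2 mu @ [2]" by blast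
    \<comment> \<open>Positivity puts the shifted smallest part above the appended 2.\<close>
    then have "mu \<noteq> [] \<Longrightarrow> 0 < last mu"
      using last_S_parts0_pos[of mu] by (simp add: S_class_def)
    with mu show ?thesis
      by (auto simp: S_class_even_last_def S_class_def S_parts0_snoc shift_in_S_parts0)
  qed
qed

text \<open>With at least two parts, the list in front of a final 1 is nonempty, so removing the 1
  leaves the largest part unchanged.\<close>

lemma S_class_decomp:
  "S_class p (Suc (Suc n)) j =
     shift2 ` S_class p (Suc (Suc n)) j \<union>
     (\<lambda>mu. shift2 mu @ [2]) ` S_class p (Suc n) j \<union>
     (if j = 0 then {} else (\<lambda>mu. mu @ [1]) ` S_class_even_last p (Suc n) (j - 1))" (is "?L = ?R")
proof (intro set_eqI iffI)
  fix lam assume "lam \<in> ?L"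
  then have lam: "lam \<in> S_parts0" "lam \<noteq> []" "largest_even lam = p" "length lam = Suc (Suc n)"
     "num_parts_cong (Suc 0) 2 lam = j"
    by (auto simp: S_class_def)
  from lam(1,2) show "lam \<in> ?R"
  proof (cases rule: S_parts0_cases)
    case (shift mu)
    with lam have "mu \<in> S_class p (Suc (Suc n)) j"
      by (auto simp: S_class_def)
    with shift show ?thesis by blast
  next
    case (two mu)
    with lam have "mu \<in> S_class p (Suc n) j"
      by (auto simp: S_class_def split: if_splits)
    with two show ?thesis by blast
  next
    case (one mu)
    with lam(4) have "mu \<noteq> []" by auto
    with one lam have "j \<noteq> 0" "mu \<in> S_class_even_last p (Suc n) (j - 1)"
      by (auto simp: S_class_def S_class_even_last_def)
    with one show ?thesis by auto
  qed
next
  fix lam assume "lam \<in> ?R"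
  then consider "lam \<in> shift2 ` S_class p (Suc (Suc n)) j"
    | "lam \<in> (\<lambda>mu. shift2 mu @ [2]) ` S_class p (Suc n) j"
    | "j \<noteq> 0" "lam \<in> (\<lambda>mu. mu @ [1]) ` S_class_even_last p (Suc n) (j - 1)"
    by (auto split: if_splits)
  then show "lam \<in> ?L"
  proof cases
    case 1
    then show ?thesis
      by (auto simp: S_class_def intro!: shift_in_S_parts0)
  next
    case 2
    then obtain mu where mu: "mu \<in> S_class p (Suc n) j" "lam = shift2 mu @ [2]" by blast
    then have "mu \<noteq> [] \<Longrightarrow> 0 < last mu"
      using last_S_parts0_pos[of mu] by (simp add: S_class_def)
    with mu show ?thesis
      by (auto simp: S_class_def S_parts0_snoc shift_in_S_parts0)
  next
    case 3
    then obtain mu where mu: "mu \<in> S_class_even_last p (Suc n) (j - 1)" "lam = mu @ [1]" by blast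
    then have "0 < last mu" "even (last mu)"
      using last_S_parts0_pos[of mu] by (auto simp: S_class_def S_class_even_last_def)
    \<comment> \<open>An even positive part is at least 2, so the appended 1 is strictly
      smaller.\<close>
    then have "1 < last mu" by (metis One_nat_def Suc_lessI odd_one)
    with mu 3(1) show ?thesis
      by (auto simp: S_class_def S_class_even_last_def S_parts0_snoc)
  qed
qed

lemma S_class_0: "S_class p 0 j = (if p \<and> j = 0 then {[]} else {})"
  by (auto simp: S_class_def)

lemma S_class_empty: "n < j \<Longrightarrow> S_class p n j = {}"
  by (auto simp: S_class_def num_parts_cong_def) (meson length_filter_le not_less)+

lemma S_class_1: "S_class p (Suc 0) j = (\<lambda>k. [k]) ` {k. 0 < k \<and> even k = p \<and> j = (if p then 0 else 1)}"
proof -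
  have "[k] \<in> S_parts0 \<longleftrightarrow> 0 < k" for k
    using S_parts0_snoc[of "[]" k] by simp
  moreover have "num_parts_cong (Suc 0) 2 [k] = (if even k then 0 else 1)" for k
    using num_parts_cong_simps(2)[of "[]" k] by simp
  ultimately show ?thesis
    by (auto simp: S_class_def largest_even_def length_Suc_conv image_iff)
qed

section \<open>Generating functions\<close>

text \<open>In this form the weight is visibly a single power of \<open>q_var\<close> with a
  constant coefficient.\<close>

lemma monomial_eq_const:
  "x_var ^ a * y_var ^ b * q_var ^ c = fps_const ([:[:0, 1:]:] ^ a * [:0, 1:] ^ b) * q_var ^ c"
  by (simp only: x_var_def y_var_def fps_const_power fps_const_mult)

lemma partition_weight_nth_nonzero:
  assumes "fps_nth (partition_weight lam) n \<noteq> 0"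
  shows "sum_list lam = n"
proof -
  have "fps_nth (fps_const k * q_var ^ c) n \<noteq> 0 \<Longrightarrow> c = n" for k :: "int poly poly" and c
    by (simp add: fps_X_power_mult_right_nth split: if_splits)
  then show ?thesis
    using assms unfolding partition_weight_def monomial_eq_const .
qed

text \<open>Since the entries are positive, \<open>n\<close> bounds the length as well as each
  entry.\<close>

lemma finite_bounded_sum: "finite {lam :: nat list. 0 \<notin> set lam \<and> sum_list lam = n}"
proof (rule finite_subset)
  have len: "length lam \<le> sum_list lam" if "0 \<notin> set lam" for lam :: "nat list"
    using that by (induction lam) (auto simp: Suc_le_eq add_strict_increasing2)
  show "{lam :: nat list. 0 \<notin> set lam \<and> sum_list lam = n} \<subseteq> {lam. set lam \<subseteq> {..n} \<and> length lam \<le> n}"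
    using len by (auto simp: member_le_sum_list)
  show "finite {lam. set lam \<subseteq> {..n} \<and> length lam \<le> n}"
    by (rule finite_lists_length_le) simp
qed

lemma partition_weight_summable:
  assumes "A \<subseteq> S_parts0"
  shows "partition_weight summable_on A"
proof (rule summable_on_fpsI)
  fix n
  show "finite {lam \<in> A. fps_nth (partition_weight lam) n \<noteq> 0}"
    by (rule finite_subset[OF _ finite_bounded_sum[of n]])
       (use assms zero_notin_S_parts0 partition_weight_nth_nonzero in auto)
qed

definition gen :: "nat list set \<Rightarrow> qseries" where
  "gen A = infsum partition_weight A"

lemma gen_Un:
  assumes "A \<subseteq> S_parts0" "B \<subseteq> S_parts0" "A \<inter> B = {}"
  shows "gen (A \<union> B) = gen A + gen B"
  unfolding gen_def using assms by (intro infsum_Un_disjoint partition_weight_summable)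

lemma gen_image:
  assumes "A \<subseteq> S_parts0" "inj_on h A"
    and "\<And>lam. lam \<in> A \<Longrightarrow> partition_weight (h lam) = c * partition_weight lam"
  shows "gen (h ` A) = c * gen A"
proof -
  have "((\<lambda>lam. c * partition_weight lam) has_sum (c * gen A)) A"
    unfolding gen_def using partition_weight_summable[OF assms(1)]
    by (intro has_sum_fps_cmult has_sum_infsum)
  then have "((partition_weight \<circ> h) has_sum (c * gen A)) A"
    using assms(3) by (simp add: has_sum_cong[where f = "partition_weight \<circ> h"])
  then have "(partition_weight has_sum (c * gen A)) (h ` A)"
    by (simp add: has_sum_reindex[OF assms(2)])
  then show ?thesis
    unfolding gen_def by (rule infsumI)
qed

lemma gen_shift:
  assumes "A \<subseteq> S_parts0" "\<And>lam. lam \<in> A \<Longrightarrow> length lam = n"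
  shows "gen (shift2 ` A) = q_var ^ (2 * n) * gen A"
proof (rule gen_image[OF assms(1)])
  show "inj_on shift2 A"
    by (rule inj_on_subset[OF inj_shift2]) simp
  fix lam assume "lam \<in> A"
  then show "partition_weight (shift2 lam) = q_var ^ (2 * n) * partition_weight lam"
    using assms(2)[of lam]
    by (simp add: partition_weight_def power_add mult_ac)
qed

text \<open>The exponent counts 2 for each of the \<open>n\<close> shifted parts and 2 for the new
  part.\<close>

lemma gen_shift_snoc:
  assumes "A \<subseteq> S_parts0" "\<And>lam. lam \<in> A \<Longrightarrow> length lam = n"
  shows "gen ((\<lambda>lam. shift2 lam @ [2]) ` A) = x_var * q_var ^ (2 * Suc n) * gen A"
proof (rule gen_image[OF assms(1)])
  show "inj_on (\<lambda>lam. shift2 lam @ [2]) A"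
    using inj_shift2 by (auto simp: inj_on_def)
  fix lam assume "lam \<in> A"
  then show "partition_weight (shift2 lam @ [2]) =
      x_var * q_var ^ (2 * Suc n) * partition_weight lam"
    using assms(2)[of lam]
    by (simp add: partition_weight_def power_add power2_eq_square mult_ac)
qed

lemma gen_snoc_1:
  assumes "A \<subseteq> S_parts0"
  shows "gen ((\<lambda>lam. lam @ [1]) ` A) = x_var * y_var * q_var * gen A"
  by (rule gen_image[OF assms]) (auto simp: inj_on_def partition_weight_def mult_ac)

section \<open>Linear equations between the generating functions of the classes\<close>

lemma S_class_subset: "S_class p n j \<subseteq> S_parts0" "S_class_even_last p n j \<subseteq> S_parts0"
  by (auto simp: S_class_def S_class_even_last_def)

lemma S_class_even_last_length: "lam \<in> S_class_even_last p n j \<Longrightarrow> length lam = n"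
  by (auto simp: S_class_even_last_def dest: S_class_length)

text \<open>The two images in the decomposition are disjoint because their smallest parts are above
  2 and equal to 2. The term of the shifted class is moved to the left.\<close>

lemma gen_S_class_even_last:
  "(1 - q_var ^ (2 * Suc n)) * gen (S_class_even_last p (Suc n) j) =
     x_var * q_var ^ (2 * Suc n) * gen (S_class p n j)"
proof -
  let ?A = "shift2 ` S_class_even_last p (Suc n) j"
  let ?B = "(\<lambda>mu. shift2 mu @ [2]) ` S_class p n j"
  have sub: "?A \<subseteq> S_parts0" "?B \<subseteq> S_parts0"
    using S_class_even_last_decomp[of p n j] S_class_subset by blast+
  have "2 < last lam" if "lam \<in> ?A" for lam
    using that by (auto simp: S_class_even_last_def S_class_def dest: last_S_parts0_pos)
  moreover have "last lam = 2" if "lam \<in> ?B" for lam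
    using that by auto
  ultimately have "?A \<inter> ?B = {}" by fastforce
  then have "gen (S_class_even_last p (Suc n) j) = gen ?A + gen ?B"
    by (subst S_class_even_last_decomp) (rule gen_Un[OF sub])
  also have "gen ?A = q_var ^ (2 * Suc n) * gen (S_class_even_last p (Suc n) j)"
    by (rule gen_shift[OF S_class_subset(2) S_class_even_last_length])
  also have "gen ?B = x_var * q_var ^ (2 * Suc n) * gen (S_class p n j)"
    by (rule gen_shift_snoc[OF S_class_subset(1) S_class_length])
  finally show ?thesis by (simp add: algebra_simps)
qed

text \<open>The same argument with three images, whose smallest parts are above 2, equal to 2 and
  equal to 1.\<close>

lemma gen_S_class:
  "(1 - q_var ^ (2 * Suc (Suc n))) * gen (S_class p (Suc (Suc n)) j) =
     x_var * q_var ^ (2 * Suc (Suc n)) * gen (S_class p (Suc n) j) +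
     (if j = 0 then 0 else x_var * y_var * q_var * gen (S_class_even_last p (Suc n) (j - 1)))"
proof -
  let ?A = "shift2 ` S_class p (Suc (Suc n)) j"
  let ?B = "(\<lambda>mu. shift2 mu @ [2]) ` S_class p (Suc n) j"
  let ?C = "if j = 0 then {} else (\<lambda>mu. mu @ [1]) ` S_class_even_last p (Suc n) (j - 1)"
  have sub: "?A \<subseteq> S_parts0" "?B \<subseteq> S_parts0" "?C \<subseteq> S_parts0"
    using S_class_decomp[of p n j] S_class_subset by blast+
  have A: "2 < last lam" if "lam \<in> ?A" for lam
  proof -
    from that obtain mu where mu: "mu \<in> S_class p (Suc (Suc n)) j" "lam = shift2 mu" by blast
    then have "mu \<in> S_parts0" "mu \<noteq> []" by (auto simp: S_class_def)
    with last_S_parts0_pos mu(2) show ?thesis by simp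
  qed
  have B: "last lam = 2" if "lam \<in> ?B" for lam
    using that by auto
  have C: "last lam = 1" if "lam \<in> ?C" for lam
    using that by (auto split: if_splits)
  have "?A \<inter> ?B = {}" using A B by fastforce
  moreover have "(?A \<union> ?B) \<inter> ?C = {}" using A B C by fastforce
  ultimately have "gen (S_class p (Suc (Suc n)) j) = gen ?A + gen ?B + gen ?C"
    using sub by (subst S_class_decomp, subst gen_Un, simp_all add: gen_Un)
  also have "gen ?A = q_var ^ (2 * Suc (Suc n)) * gen (S_class p (Suc (Suc n)) j)"
    by (rule gen_shift[OF S_class_subset(1) S_class_length])
  also have "gen ?B = x_var * q_var ^ (2 * Suc (Suc n)) * gen (S_class p (Suc n) j)"
    by (rule gen_shift_snoc[OF S_class_subset(1) S_class_length])
  also have "gen ?C =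
      (if j = 0 then 0 else x_var * y_var * q_var * gen (S_class_even_last p (Suc n) (j - 1)))"
    using gen_snoc_1[OF S_class_subset(2)] by (simp add: gen_def)
  finally show ?thesis by (simp add: algebra_simps)
qed

section \<open>Solution of the recurrence\<close>

abbreviation (input) q2_poch :: "nat \<Rightarrow> qseries" where
  "q2_poch \<equiv> q_pochhammer (q_var\<^sup>2) (q_var\<^sup>2)"

abbreviation (input) q2_binomial :: "nat \<Rightarrow> nat \<Rightarrow> qseries" where
  "q2_binomial \<equiv> q_binomial (q_var\<^sup>2)"

lemma q2_nth_0 [simp]: "fps_nth (q_var\<^sup>2 :: qseries) 0 = 0"
  by (simp add: fps_X_power_nth)

lemma q2_poch_Suc: "q2_poch (Suc n) = q2_poch n * (1 - q_var ^ (2 * Suc n))"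
proof -
  have "q_var\<^sup>2 * (q_var\<^sup>2) ^ n = (q_var ^ (2 * Suc n) :: qseries)"
    by (simp only: power_mult[symmetric] power_add[symmetric]) simp
  then show ?thesis by (simp add: q_pochhammer_Suc)
qed

lemma q2_poch_0: "q2_poch 0 = 1"
  by (simp add: q_pochhammer_def)

text \<open>This is the series $U_{n,j}$ of the overview, for either parity
  \<open>p\<close>.\<close>

definition class_numerator :: "bool \<Rightarrow> nat \<Rightarrow> nat \<Rightarrow> qseries" where
  "class_numerator p n j = gen (S_class p n j) * q2_poch n"

text \<open>The last factor of \<open>q2_poch (Suc (Suc n))\<close> clears
  \<open>gen_S_class\<close>; the one before it clears \<open>gen_S_class_even_last\<close>. The
  exponent 2n + 3 is 1 for the appended part plus 2(n + 1).\<close>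

lemma class_numerator_rec:
  "class_numerator p (Suc (Suc n)) j =
     x_var * q_var ^ (2 * Suc (Suc n)) * class_numerator p (Suc n) j +
     (if j = 0 then 0 else x_var\<^sup>2 * y_var * q_var ^ (2 * n + 3) * class_numerator p n (j - 1))"
proof -
  let ?u = "1 - q_var ^ (2 * Suc n) :: qseries"
  let ?e = "gen (S_class_even_last p (Suc n) (j - 1))"
  have e: "?u * ?e = x_var * q_var ^ (2 * Suc n) * gen (S_class p n (j - 1))"
    by (rule gen_S_class_even_last)
  have "class_numerator p (Suc (Suc n)) j =
      ((1 - q_var ^ (2 * Suc (Suc n))) * gen (S_class p (Suc (Suc n)) j)) * q2_poch (Suc n)"
    unfolding class_numerator_def q2_poch_Suc[of "Suc n"] by (simp only: mult_ac)
  also have "\<dots> = x_var * q_var ^ (2 * Suc (Suc n)) * class_numerator p (Suc n) j +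
      (if j = 0 then 0 else x_var * y_var * q_var * (?u * ?e) * q2_poch n)"
    unfolding gen_S_class class_numerator_def by (simp add: q2_poch_Suc[of n] algebra_simps)
  also have "(if j = 0 then 0 else x_var * y_var * q_var * (?u * ?e) * q2_poch n) =
      (if j = 0 then 0 else x_var\<^sup>2 * y_var * q_var ^ (2 * n + 3) * class_numerator p n (j - 1))"
    unfolding e class_numerator_def by (simp add: power_add power2_eq_square power3_eq_cube mult_ac)
  finally show ?thesis .
qed

lemma class_numerator_rec_0:
  "class_numerator p (Suc (Suc n)) 0 = x_var * q_var ^ (2 * Suc (Suc n)) * class_numerator p (Suc n) 0"
  by (subst class_numerator_rec) simp

lemma class_numerator_rec_Suc:
  "class_numerator p (Suc (Suc n)) (Suc j) =
     x_var * q_var ^ (2 * Suc (Suc n)) * class_numerator p (Suc n) (Suc j) +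
     x_var\<^sup>2 * y_var * q_var ^ (2 * n + 3) * class_numerator p n j"
  by (simp only: class_numerator_rec nat.distinct if_False diff_Suc_1)

lemma class_numerator_eq_0: "n < j \<Longrightarrow> class_numerator p n j = 0"
  by (simp add: class_numerator_def S_class_empty gen_def)

text \<open>Two or more parts cannot all be odd. In the recurrence both terms ask for more odd parts
  than there are parts.\<close>

lemma class_numerator_diagonal: "class_numerator p (Suc (Suc n)) (Suc (Suc n)) = 0"
  by (simp add: class_numerator_rec_Suc class_numerator_eq_0)

section \<open>Initial values of the recurrence\<close>

lemma gen_singleton: "gen {lam} = partition_weight lam"
  by (simp add: gen_def)

lemma partition_weight_Nil: "partition_weight [] = 1"
  by (simp add: partition_weight_def)

lemma class_numerator_0: "class_numerator p 0 j = (if p \<and> j = 0 then 1 else 0)"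
  by (simp add: class_numerator_def S_class_0 q2_poch_0 gen_singleton partition_weight_Nil) (simp add: gen_def)

text \<open>For a single part the largest is also the smallest, so the equation for even smallest
  part applies with \<open>n = 0\<close> and no geometric series has to be summed.\<close>

lemma class_numerator_True_1:
  "class_numerator True (Suc 0) j = (if j = 0 then x_var * q_var\<^sup>2 else 0)"
proof -
  have "S_class_even_last True (Suc 0) j = S_class True (Suc 0) j"
    by (auto simp: S_class_even_last_def S_class_1)
  then have "class_numerator True (Suc 0) j = (1 - q_var ^ (2 * Suc 0)) * gen (S_class_even_last True (Suc 0) j)"
    by (simp add: class_numerator_def q2_poch_Suc q2_poch_0 mult.commute)
  also have "\<dots> = x_var * q_var\<^sup>2 * class_numerator True 0 j"
    unfolding gen_S_class_even_last by (simp add: class_numerator_def q2_poch_0)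
  finally show ?thesis by (simp add: class_numerator_0)
qed

text \<open>\<open>gen_S_class\<close> starts at two parts, so odd singletons are treated directly:
  each is \<open>[1]\<close> or the shift of another one.\<close>

lemma class_numerator_False_1:
  "class_numerator False (Suc 0) j = (if j = Suc 0 then x_var * y_var * q_var else 0)"
proof (cases "j = Suc 0")
  case False
  then have "S_class False (Suc 0) j = {}" by (auto simp: S_class_1)
  with False show ?thesis by (simp add: class_numerator_def gen_def)
next
  case True
  let ?O = "S_class False (Suc 0) (Suc 0)"
  have O: "?O = (\<lambda>k. [k]) ` {k. odd k}"
    using S_class_1[of False "Suc 0"] by (auto intro: gr0I)
  have "{k. odd k} = (\<lambda>k. k + 2) ` {k. odd k} \<union> {1 :: nat}"
  proof -
    have "k \<in> (\<lambda>k. k + 2) ` {k. odd k} \<union> {1}" if "odd k" for k :: nat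
    proof (cases "k = 1")
      case False
      with that have "k = (k - 2) + 2" "odd (k - 2)" by (auto elim!: oddE)
      then show ?thesis by blast
    qed simp
    then show ?thesis by auto
  qed
  then have decomp: "?O = shift2 ` ?O \<union> {[1]}"
    unfolding O image_image shift2_def by (metis (no_types, lifting) image_Un image_cong image_empty image_image image_insert list.simps(8,9))
  have "[1] \<notin> shift2 ` ?O" by (auto simp: O shift2_def)
  then have "gen ?O = gen (shift2 ` ?O) + gen {[1]}"
    using decomp S_class_subset(1)[of False "Suc 0" "Suc 0"]
    by (subst decomp, intro gen_Un) auto
  also have "gen (shift2 ` ?O) = q_var ^ (2 * Suc 0) * gen ?O"
    by (rule gen_shift[OF S_class_subset(1) S_class_length])
  also have "gen {[1]} = x_var * y_var * q_var"
    by (simp add: gen_singleton partition_weight_def num_parts_cong_def)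
  finally have "gen ?O * (1 - q_var ^ (2 * Suc 0)) = x_var * y_var * q_var"
    by (simp add: algebra_simps)
  with True show ?thesis
    by (simp add: class_numerator_def q2_poch_Suc q2_poch_0)
qed

section \<open>Closed forms for the two parities of the largest part\<close>

lemma x_q_monomial:
  "x_var * q_var ^ d * (x_var ^ a * y_var ^ b * q_var ^ c) = x_var ^ Suc a * y_var ^ b * q_var ^ (c + d)"
  by (simp add: power_add mult_ac)

text \<open>The shift \<open>d\<close> is 0 for an even and 1 for an odd largest part; \<open>i\<close> and \<open>j\<close> index the
  binomial coefficient, so that \<open>i + j + 2 + d\<close> is the number of parts.\<close>

lemma pascal_step:
  assumes "c1 + 2 * (i + j + 2 + d) = c + 2 * Suc j" "c2 + 2 * (i + j + d) + 3 = c"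
    and "a1 + 1 = a" "a2 + 2 = a" "b2 + 1 = b"
  shows "x_var * q_var ^ (2 * (i + j + 2 + d)) * (x_var ^ a1 * y_var ^ b * q_var ^ c1 * q2_binomial i (Suc j)) +
      x_var\<^sup>2 * y_var * q_var ^ (2 * (i + j + d) + 3) * (x_var ^ a2 * y_var ^ b2 * q_var ^ c2 * q2_binomial i j) =
    x_var ^ a * y_var ^ b * q_var ^ c * q2_binomial (Suc i) (Suc j)"
proof -
  \<comment> \<open>The first term carries the extra factor of the Pascal rule at base
    \<open>q_var\<^sup>2\<close>; the second carries none.\<close>
  have 1: "x_var * q_var ^ (2 * (i + j + 2 + d)) * (x_var ^ a1 * y_var ^ b * q_var ^ c1) =
      x_var ^ a * y_var ^ b * q_var ^ c * (q_var\<^sup>2) ^ Suc j"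
    unfolding x_q_monomial assms(1)
    unfolding power_add[of q_var] power_mult[of q_var 2]
    by (simp add: mult_ac flip: assms(3))
  have 2: "x_var\<^sup>2 * y_var * q_var ^ (2 * (i + j + d) + 3) * (x_var ^ a2 * y_var ^ b2 * q_var ^ c2) =
      x_var ^ a * y_var ^ b * q_var ^ c"
    unfolding assms(4,5)[symmetric] assms(2)[symmetric] power_add power_one_right by (simp only: mult_ac)
  show ?thesis
    unfolding mult.assoc[symmetric] 1[unfolded mult.assoc[symmetric]] 2[unfolded mult.assoc[symmetric]]
    by (simp only: q_binomial_pascal[OF q2_nth_0] distrib_left mult_ac)
qed

text \<open>Here \<open>i\<close> counts the even parts. Both terms of the recurrence have one even
  part fewer than the left side, hence induction on \<open>i\<close> with \<open>j\<close>
  arbitrary.\<close>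

lemma class_numerator_True:
  "class_numerator True (i + j) j =
     x_var ^ (i + j) * y_var ^ j * q_var ^ (i\<^sup>2 + j\<^sup>2 + i) * q2_binomial i j"
proof (induction i arbitrary: j)
  case 0
  consider "j = 0" | "j = Suc 0" | k where "j = Suc (Suc k)"
    by (metis One_nat_def not0_implies_Suc)
  then show ?case
    using class_numerator_True_1[of 1]
    by cases (auto simp: class_numerator_0 class_numerator_diagonal q_binomial_0 q_binomial_eq_0)
next
  case (Suc i)
  show ?case
  proof (cases j)
    case 0
    \<comment> \<open>Without odd parts the recurrence has a single term, and \<open>e\<close>
      updates its exponent.\<close>
    have e: "i\<^sup>2 + i + 2 * Suc i = (Suc i)\<^sup>2 + Suc i" by (simp add: power2_eq_square)
    show ?thesis
    proof (cases i)
      case 0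
      then show ?thesis
        using class_numerator_True_1[of 0] \<open>j = 0\<close> by (simp add: q_binomial_0 power2_eq_square)
    next
      case (Suc k)
      then show ?thesis
        using Suc.IH[of 0] class_numerator_rec_0[of True k] \<open>j = 0\<close>
          x_q_monomial[of "2 * Suc i" i 0 "i\<^sup>2 + i", unfolded e]
        by (simp add: q_binomial_0 del: power_Suc)
    qed
  next
    case (Suc k)
    have "class_numerator True (Suc i + Suc k) (Suc k) =
      x_var * q_var ^ (2 * (i + k + 2 + 0)) * class_numerator True (i + Suc k) (Suc k) +
      x_var\<^sup>2 * y_var * q_var ^ (2 * (i + k + 0) + 3) * class_numerator True (i + k) k"
      using class_numerator_rec_Suc[of True "i + k" k] by simp
    also have "\<dots> = x_var ^ (Suc i + Suc k) * y_var ^ Suc k * q_var ^ ((Suc i)\<^sup>2 + (Suc k)\<^sup>2 + Suc i) *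
        q2_binomial (Suc i) (Suc k)"
      unfolding Suc.IH by (rule pascal_step) (simp_all add: power2_eq_square)
    finally show ?thesis unfolding Suc .
  qed
qed

text \<open>An odd largest part is itself an odd part; here the vanishing follows from the
  recurrence and its initial values.\<close>

lemma class_numerator_False_no_odd: "class_numerator False n 0 = 0"
proof (induction n rule: less_induct)
  case (less n)
  consider "n = 0" | "n = 1" | k where "n = Suc (Suc k)"
    by (metis One_nat_def not0_implies_Suc)
  then show ?case
    using less class_numerator_False_1[of 0]
    by cases (auto simp: class_numerator_0 class_numerator_rec_0)
qed

text \<open>Again \<open>i\<close> counts the even parts, while \<open>j\<close> is one less than
  the number of odd parts. The induction is the one for \<open>class_numerator_True\<close>.\<close>

lemma class_numerator_False:
  "class_numerator False (Suc (i + j)) (Suc j) =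
     x_var ^ Suc (i + j) * y_var ^ Suc j * q_var ^ ((Suc i)\<^sup>2 + j\<^sup>2 + i) * q2_binomial i j"
proof (induction i arbitrary: j)
  case 0
  show ?case
    using class_numerator_False_1[of 1]
    by (cases j) (auto simp: class_numerator_diagonal q_binomial_0 q_binomial_eq_0)
next
  case (Suc i)
  show ?case
  proof (cases j)
    case 0
    have e: "(Suc i)\<^sup>2 + i + 2 * Suc (Suc i) = (Suc (Suc i))\<^sup>2 + Suc i" by (simp add: power2_eq_square)
    have "class_numerator False (Suc (Suc i)) (Suc 0) =
        x_var * q_var ^ (2 * Suc (Suc i)) * class_numerator False (Suc i) (Suc 0)"
      by (simp add: class_numerator_rec_Suc class_numerator_False_no_odd)
    also have "class_numerator False (Suc i) (Suc 0) =
        x_var ^ Suc i * y_var ^ Suc 0 * q_var ^ ((Suc i)\<^sup>2 + i)"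
      using Suc.IH[of 0] by (simp add: q_binomial_0)
    finally show ?thesis
      unfolding x_q_monomial e 0 by (simp add: q_binomial_0)
  next
    case (Suc k)
    have "class_numerator False (Suc (Suc i + Suc k)) (Suc (Suc k)) =
      x_var * q_var ^ (2 * (i + k + 2 + 1)) * class_numerator False (Suc (i + Suc k)) (Suc (Suc k)) +
      x_var\<^sup>2 * y_var * q_var ^ (2 * (i + k + 1) + 3) * class_numerator False (Suc (i + k)) (Suc k)"
      using class_numerator_rec_Suc[of False "Suc (i + k)" "Suc k"] by simp
    also have "\<dots> = x_var ^ Suc (Suc i + Suc k) * y_var ^ Suc (Suc k) *
        q_var ^ ((Suc (Suc i))\<^sup>2 + (Suc k)\<^sup>2 + Suc i) * q2_binomial (Suc i) (Suc k)"
      unfolding Suc.IH by (rule pascal_step) (simp_all add: power2_eq_square)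
    finally show ?thesis unfolding Suc .
  qed
qed

text \<open>\<open>q2_poch n\<close> has constant coefficient 1, so the quotient is exact and the
  factor cancels.\<close>

lemma mult_q2_poch_eqD:
  assumes "g * q2_poch n = m * b"
  shows "g = fps_quot m (q2_poch n) * b"
proof -
  have "fps_quot m (q2_poch n) * q2_poch n = m"
    by (rule fps_quot_mult) (rule fps_nth_0_q_pochhammer, simp)
  then have "g * q2_poch n = fps_quot m (q2_poch n) * b * q2_poch n"
    using assms by (simp add: mult_ac)
  then show ?thesis
    using q_pochhammer_fps_nonzero[OF q2_nth_0] by simp
qed

text \<open>Turns a closed form of \<open>class_numerator\<close> into one of the generating
  function of the class.\<close>

lemmas gen_S_class_eqI = mult_q2_poch_eqD[OF class_numerator_def[symmetric, THEN trans]]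

lemma class_numerator_sum:
  "class_numerator True (i + j) j + class_numerator False (i + j) j =
     x_var ^ (i + j) * y_var ^ j * q_var ^ (i\<^sup>2 + j\<^sup>2 + i) * q2_binomial (i + 1) j"
proof (cases j)
  case 0
  then show ?thesis
    using class_numerator_True[of i 0] by (simp add: class_numerator_False_no_odd q_binomial_0)
next
  case (Suc k)
  have F: "class_numerator False (i + Suc k) (Suc k) =
      x_var ^ (i + Suc k) * y_var ^ Suc k * q_var ^ ((Suc i)\<^sup>2 + k\<^sup>2 + i) * q2_binomial i k"
    using class_numerator_False[of i k] by (simp only: add_Suc_right)
  show ?thesis
  proof (cases "k \<le> i")
    case True
    \<comment> \<open>The surplus \<open>2 * (i - k)\<close> is the power of
      \<open>q_var\<^sup>2\<close> in \<open>q_binomial_pascal'\<close>. For \<open>k > i\<close>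
      all three binomial coefficients vanish.\<close>
    then have "(Suc i)\<^sup>2 + k\<^sup>2 + i = i\<^sup>2 + (Suc k)\<^sup>2 + i + 2 * (i - k)"
      by (simp add: power2_eq_square)
    then have "q_var ^ ((Suc i)\<^sup>2 + k\<^sup>2 + i) = q_var ^ (i\<^sup>2 + (Suc k)\<^sup>2 + i) * ((q_var :: qseries)\<^sup>2) ^ (i - k)"
      by (simp only: power_add power_mult)
    then show ?thesis
      unfolding Suc class_numerator_True F Suc_eq_plus1[of i, symmetric] q_binomial_pascal'[OF q2_nth_0 True]
      by (simp only: distrib_left mult_ac)
  next
    case False
    then show ?thesis
      unfolding Suc class_numerator_True F by (simp add: q_binomial_eq_0)
  qed
qed

section \<open>Summation over the number of even and odd parts\<close>

text \<open>The sum over \<open>A\<close> is reindexed over pairs of an index and a member of its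
  fibre, and then summed fibre by fibre.\<close>

lemma has_sum_gen_fibres:
  assumes A: "A \<subseteq> S_parts0" and idx: "idx ` A \<subseteq> I"
    and T: "\<And>a. a \<in> I \<Longrightarrow> gen {lam \<in> A. idx lam = a} = T a"
  shows "(T has_sum gen A) I"
proof (rule has_sum_SigmaD)
  let ?C = "\<lambda>a. {lam \<in> A. idx lam = a}"
  have "bij_betw snd (Sigma I ?C) A"
    by (rule bij_betw_byWitness[where f' = "\<lambda>lam. (idx lam, lam)"]) (use idx in auto)
  then show "((\<lambda>z. partition_weight (snd z)) has_sum gen A) (Sigma I ?C)"
    unfolding gen_def
    by (simp add: has_sum_reindex_bij_betw partition_weight_summable[OF A] flip: summable_iff_has_sum_infsum)
  fix a assume "a \<in> I"
  have "?C a \<subseteq> S_parts0" using A by auto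
  then have "(partition_weight has_sum gen (?C a)) (?C a)"
    unfolding gen_def by (intro has_sum_infsum partition_weight_summable)
  then show "((\<lambda>lam. partition_weight (snd (a, lam))) has_sum T a) (?C a)"
    using T[OF \<open>a \<in> I\<close>] by simp
qed

section \<open>The sets of the theorem and their sums\<close>

lemma Max_S_parts: "lam \<in> S_parts \<Longrightarrow> Max (set lam) = hd lam"
  by (cases lam) (auto simp: S_parts_def is_partition_def intro!: Max_eqI)

lemma S_even_eq: "S_even = {lam \<in> S_parts0. lam \<noteq> [] \<and> largest_even lam}"
  using Max_S_parts by (auto simp: S_even_def S_parts0_eq largest_even_def) (auto simp: S_parts_def)

lemma S_odd_eq: "S_odd = {lam \<in> S_parts0. \<not> largest_even lam}"
  using Max_S_parts by (auto simp: S_odd_def S_parts0_eq largest_even_def) (auto simp: S_parts_def)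

lemma num_odd_le_length: "num_parts_cong (Suc 0) 2 lam \<le> length lam"
  by (simp add: num_parts_cong_def)

lemma num_odd_less_length:
  assumes "largest_even lam" "lam \<noteq> []"
  shows "num_parts_cong (Suc 0) 2 lam < length lam"
  unfolding num_parts_cong_def using assms
  by (intro length_filter_less[of "hd lam"]) (auto simp: largest_even_def)

lemma num_odd_pos: "\<not> largest_even lam \<Longrightarrow> 0 < num_parts_cong (Suc 0) 2 lam"
  by (cases lam) (auto simp: largest_even_def num_parts_cong_def odd_iff_mod_2_eq_one)

text \<open>The indices are the numbers of even and of odd parts; the first is positive because the
  largest part is even.\<close>

lemma has_sum_S_even:
  "((\<lambda>(i, j). fps_quot (x_var ^ (i + j) * y_var ^ j * q_var ^ (i\<^sup>2 + j\<^sup>2 + i)) (q2_poch (i + j))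
      * q2_binomial i j) has_sum gen S_even) ({1..} \<times> {0..})"
proof (rule has_sum_gen_fibres)
  let ?idx = "\<lambda>lam. (length lam - num_parts_cong (Suc 0) 2 lam, num_parts_cong (Suc 0) 2 lam)"
  show "S_even \<subseteq> S_parts0" by (auto simp: S_even_eq)
  show "?idx ` S_even \<subseteq> {1..} \<times> {0..}"
    using num_odd_less_length by (auto simp: S_even_eq Suc_le_eq)
  fix a :: "nat \<times> nat" assume "a \<in> {1..} \<times> {0..}"
  then obtain i j where a: "a = (i, j)" "1 \<le> i" by auto
  have "{lam \<in> S_even. ?idx lam = a} = S_class True (i + j) j"
    using a num_odd_le_length by (force simp: S_even_eq S_class_def)
  then show "gen {lam \<in> S_even. ?idx lam = a} =
      (case a of (i, j) \<Rightarrow> fps_quot (x_var ^ (i + j) * y_var ^ j * q_var ^ (i\<^sup>2 + j\<^sup>2 + i)) (q2_poch (i + j))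
        * q2_binomial i j)"
    using gen_S_class_eqI[OF class_numerator_True] a by simp
qed

text \<open>The first index is one more than the number of even parts, the second one less than the
  number of odd parts.\<close>

lemma has_sum_S_odd:
  "((\<lambda>(i, j). fps_quot (x_var ^ (i + j) * y_var ^ (j + 1) * q_var ^ (i\<^sup>2 + j\<^sup>2 + i - 1)) (q2_poch (i + j))
      * q2_binomial (i - 1) j) has_sum gen S_odd) ({1..} \<times> {0..})"
proof (rule has_sum_gen_fibres)
  let ?idx = "\<lambda>lam. (length lam + 1 - num_parts_cong (Suc 0) 2 lam, num_parts_cong (Suc 0) 2 lam - 1)"
  show "S_odd \<subseteq> S_parts0" by (auto simp: S_odd_eq)
  \<comment> \<open>The truncated subtractions are exact: there is an odd part, and no more odd
    parts than parts.\<close>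
  have idx: "?idx lam = (i, j) \<longleftrightarrow> length lam = i + j \<and> num_parts_cong (Suc 0) 2 lam = Suc j"
    if "lam \<in> S_odd" "1 \<le> i" for lam i j
    using num_odd_pos[of lam] num_odd_le_length[of lam] that by (auto simp: S_odd_eq)
  show "?idx ` S_odd \<subseteq> {1..} \<times> {0..}"
    using num_odd_le_length by (auto simp: S_odd_eq Suc_le_eq less_Suc_eq_le)
  fix a :: "nat \<times> nat" assume "a \<in> {1..} \<times> {0..}"
  then obtain i j where a: "a = (Suc i, j)" by (cases a) (auto simp: Suc_le_eq gr0_conv_Suc)
  have "{lam \<in> S_odd. ?idx lam = a} = {lam \<in> S_odd. length lam = Suc i + j \<and> num_parts_cong (Suc 0) 2 lam = Suc j}"
    using idx[of _ "Suc i" j] unfolding a by (intro Collect_cong conj_cong refl) simp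
  also have "\<dots> = S_class False (Suc (i + j)) (Suc j)"
    by (auto simp: S_odd_eq S_class_def)
  finally show "gen {lam \<in> S_odd. ?idx lam = a} =
      (case a of (i, j) \<Rightarrow> fps_quot (x_var ^ (i + j) * y_var ^ (j + 1) * q_var ^ (i\<^sup>2 + j\<^sup>2 + i - 1)) (q2_poch (i + j))
        * q2_binomial (i - 1) j)"
    using gen_S_class_eqI[OF class_numerator_False, of i j] by (simp only: a prod.case) simp
qed

lemma has_sum_S_parts0:
  "((\<lambda>(i, j). fps_quot (x_var ^ (i + j) * y_var ^ j * q_var ^ (i\<^sup>2 + j\<^sup>2 + i)) (q2_poch (i + j))
      * q2_binomial (i + 1) j) has_sum gen S_parts0) ({0..} \<times> {0..})"
proof (rule has_sum_gen_fibres)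
  let ?idx = "\<lambda>lam. (length lam - num_parts_cong (Suc 0) 2 lam, num_parts_cong (Suc 0) 2 lam)"
  show "S_parts0 \<subseteq> S_parts0" "?idx ` S_parts0 \<subseteq> {0..} \<times> {0..}" by auto
  fix a :: "nat \<times> nat" assume "a \<in> {0..} \<times> {0..}"
  obtain i j where a: "a = (i, j)" by (cases a)
  let ?m = "x_var ^ (i + j) * y_var ^ j * q_var ^ (i\<^sup>2 + j\<^sup>2 + i)"
  have "{lam \<in> S_parts0. ?idx lam = a} = S_class True (i + j) j \<union> S_class False (i + j) j"
    using a num_odd_le_length by (force simp: S_class_def)
  then have "gen {lam \<in> S_parts0. ?idx lam = a} = gen (S_class True (i + j) j) + gen (S_class False (i + j) j)"
    \<comment> \<open>The two classes are disjoint because \<open>largest_even\<close> differs on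
      them.\<close>
    using S_class_subset(1) by (simp only:) (rule gen_Un, auto simp: S_class_def)
  also have "\<dots> = fps_quot ?m (q2_poch (i + j)) * q2_binomial (i + 1) j"
  proof (rule mult_q2_poch_eqD)
    show "(gen (S_class True (i + j) j) + gen (S_class False (i + j) j)) * q2_poch (i + j) = ?m * q2_binomial (i + 1) j"
      using class_numerator_sum[of i j] by (simp add: class_numerator_def distrib_right)
  qed
  finally show "gen {lam \<in> S_parts0. ?idx lam = a} =
      (case a of (i, j) \<Rightarrow> fps_quot (x_var ^ (i + j) * y_var ^ j * q_var ^ (i\<^sup>2 + j\<^sup>2 + i)) (q2_poch (i + j))
        * q2_binomial (i + 1) j)"
    unfolding a prod.case .
qed

lemma gen_S_parts0: "gen S_parts0 = 1 + gen S_parts"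
proof -
  have "gen ({[]} \<union> S_parts) = gen {[]} + gen S_parts"
    by (rule gen_Un) (auto simp: S_parts0_eq S_parts_def)
  then show ?thesis
    by (simp add: S_parts0_eq gen_singleton partition_weight_Nil)
qed

theorem theorem1p3:
  shows
    "partition_weight summable_on S_parts \<and>
     (\<lambda>(i::nat, j::nat).
        fps_quot (x_var ^ (i + j) * y_var ^ j * q_var ^ (i\<^sup>2 + j\<^sup>2 + i))
                 (q_pochhammer (q_var\<^sup>2) (q_var\<^sup>2) (i + j))
          * q_binomial (q_var\<^sup>2) (i + 1) j) summable_on ({0..} \<times> {0..}) \<and>
     1 + (\<Sum>\<^sub>\<infinity>lam\<in>S_parts. partition_weight lam) =
       (\<Sum>\<^sub>\<infinity>(i::nat, j::nat)\<in>{0..} \<times> {0..}.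
          fps_quot (x_var ^ (i + j) * y_var ^ j * q_var ^ (i\<^sup>2 + j\<^sup>2 + i))
                   (q_pochhammer (q_var\<^sup>2) (q_var\<^sup>2) (i + j))
            * q_binomial (q_var\<^sup>2) (i + 1) j) \<and>

     partition_weight summable_on S_even \<and>
     (\<lambda>(i::nat, j::nat).
        fps_quot (x_var ^ (i + j) * y_var ^ j * q_var ^ (i\<^sup>2 + j\<^sup>2 + i))
                 (q_pochhammer (q_var\<^sup>2) (q_var\<^sup>2) (i + j))
          * q_binomial (q_var\<^sup>2) i j) summable_on ({1..} \<times> {0..}) \<and>
     (\<Sum>\<^sub>\<infinity>lam\<in>S_even. partition_weight lam) =
       (\<Sum>\<^sub>\<infinity>(i::nat, j::nat)\<in>{1..} \<times> {0..}.
          fps_quot (x_var ^ (i + j) * y_var ^ j * q_var ^ (i\<^sup>2 + j\<^sup>2 + i))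
                   (q_pochhammer (q_var\<^sup>2) (q_var\<^sup>2) (i + j))
            * q_binomial (q_var\<^sup>2) i j) \<and>

     partition_weight summable_on S_odd \<and>
     (\<lambda>(i::nat, j::nat).
        fps_quot (x_var ^ (i + j) * y_var ^ (j + 1) * q_var ^ (i\<^sup>2 + j\<^sup>2 + i - 1))
                 (q_pochhammer (q_var\<^sup>2) (q_var\<^sup>2) (i + j))
          * q_binomial (q_var\<^sup>2) (i - 1) j) summable_on ({1..} \<times> {0..}) \<and>
     (\<Sum>\<^sub>\<infinity>lam\<in>S_odd. partition_weight lam) =
       (\<Sum>\<^sub>\<infinity>(i::nat, j::nat)\<in>{1..} \<times> {0..}.
          fps_quot (x_var ^ (i + j) * y_var ^ (j + 1) * q_var ^ (i\<^sup>2 + j\<^sup>2 + i - 1))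
                   (q_pochhammer (q_var\<^sup>2) (q_var\<^sup>2) (i + j))
            * q_binomial (q_var\<^sup>2) (i - 1) j)"
proof -
  have S: "(partition_weight has_sum gen A) A" if "A \<subseteq> S_parts0" for A
    unfolding gen_def by (intro has_sum_infsum partition_weight_summable that)
  have "S_parts \<subseteq> S_parts0" "S_even \<subseteq> S_parts0" "S_odd \<subseteq> S_parts0"
    by (auto simp: S_parts0_eq S_even_def S_odd_def)
  \<comment> \<open>Each \<open>has_sum\<close> fact yields both the summability claim and the
    value; in each identity the two sides then agree as values of \<open>gen\<close>.\<close>
  note hs = this[THEN S] has_sum_S_parts0 has_sum_S_even has_sum_S_odd
  note eqs = hs[THEN infsumI]
  show ?thesis
    unfolding eqs gen_S_parts0 by (intro conjI refl hs[THEN has_sum_imp_summable])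
qed

end
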